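(* Let $\mathcal{C}\subseteq\mathbb{R}^p$ be convex and let $R_n$ (the empirical risk) and $R=\mathbb{E}R_n$ (the risk) be differentiable real-valued functions on $\mathcal{C}$, with gradients $\dot R_n$ and $\dot R$. Suppose there is an increasing, strictly convex, non-negative function $G$ on $[0,\infty)$ with $G(0)=0$ and a semi-norm $\tau$ such that for all $\beta_1,\beta_2\in\mathcal{C}$ $$R(\beta_1)-R(\beta_2)-\dot R(\beta_2)^T(\beta_1-\beta_2)\ge G(\tau(\beta_1-\beta_2)).$$ Let $H(v)=\sup_{u\ge0}\{uv-G(u)\}$ be the convex conjugate of $G$. Let $\beta^\star\in\mathcal{C}$ be a non-random vector, let $S^\star\subset\{1,\dots,p\}$, and let $\Omega$ be a norm on $\mathbb{R}^p$ that is weakly decomposable for $S^\star$, with associated norm $\Omega^{S^{\star c}}$ on $\mathbb{R}^{p-|S^\star|}$ and $\underline\Omega(\beta):=\Omega(\beta_{S^\star})+\Omega^{S^{\star c}}(\beta_{S^{\star c}})$. Let $\lambda_\varepsilon>0$, $\lambda_*\ge0$ and $0\le\gamma<1$ be such that for all $\beta'\in\mathcal{C}$ $$\left|\left(\dot R_n(\beta')-\dot R(\beta')\right)^T(\beta^\star-\beta')\right|\le\lambda_\varepsilon\,\underline\Omega(\beta'-\beta^\star)+\gamma\,G(\tau(\beta'-\beta^\star))+\lambda_*.$$ Let $\lambda>\lambda_\varepsilon$ and $0\le\delta<1$, and define $\underline\lambda=\lambda-\lambda_\varepsilon$, $\overline\lambda=\lambda+\lambda_\varepsilon+\delta\underline\lambda$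 and $L=\overline\lambda/((1-\delta)\underline\lambda)$. Let $\tilde\beta\in\mathcal{C}$ be a stationary point, i.e. there is $\tilde z\in\partial\Omega(\tilde\beta)$ with $$(\dot R_n(\tilde\beta)+\lambda\tilde z)^T(\beta-\tilde\beta)\ge0\quad\text{for all }\beta\in\mathcal{C}.$$ Then $$\delta\underline\lambda\,\underline\Omega(\tilde\beta-\beta^\star)+R(\tilde\beta)\le R(\beta^\star)+(1-\gamma)H\!\left(\frac{\overline\lambda\,\Gamma_\Omega(\tau,L,S^\star)}{1-\gamma}\right)+2\lambda\,\Omega(\beta^\star_{S^{\star c}})+\lambda_*.$$
   Context: For $S\subset\{1,\dots,p\}$ and $\beta\in\mathbb{R}^p$, $\beta_S$ is the vector with entries $\beta_j\mathbf 1\{j\in S\}$; $\beta_{S^c}$ is defined likewise and is also regarded as an element of $\mathbb{R}^{p-|S|}$. A norm $\Omega$ on $\mathbb{R}^p$ is weakly decomposable for $S$ if there is a norm $\Omega^{S^c}$ on $\mathbb{R}^{p-|S|}$ such that $\Omega(\beta)\ge\Omega(\beta_S)+\Omega^{S^c}(\beta_{S^c})$ for all $\beta\in\mathbb{R}^p$. The dual norm is $\Omega_*(w)=\sup_{\Omega(\beta)\le1}|w^T\beta|$. The subdifferential is $\partial\Omega(\beta)=\{z:\Omega_*(z)\le1\}$ if $\beta=0$, and $\partial\Omega(\beta)=\{z:\Omega_*(z)=1,\ z^T\beta=\Omega(\beta)\}$ if $\beta\neq0$. For $L>0$, the $\Omega$-eigenvalue is $\delta_\Omega(\tau,L,S)=\min\{\tau(\beta_S-\beta_{S^c}):\Omega(\beta_S)=1,\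 \Omega^{S^c}(\beta_{S^c})\le L\}$, and the effective sparsity $\Gamma_\Omega(\tau,L,S)\ge0$ is given by $\Gamma_\Omega^2(\tau,L,S)=1/\delta_\Omega^2(\tau,L,S)$. If $\delta_\Omega=0$ then $\Gamma_\Omega=\infty$ and the bound is trivial. *)

theory Defs
  imports "HOL-Probability.Probability"
begin

definition restr :: "'n set \<Rightarrow> real ^ 'n \<Rightarrow> real ^ 'n" where
  "restr S \<beta> = (\<chi> j. if j \<in> S then \<beta> $ j else 0)"

text \<open>The coordinate subspace of vectors supported on \<open>T\<close>. It serves as the copy of
  \<open>\<real>\<close> to the power \<open>|T|\<close>, so that \<^term>\<open>restr T \<beta>\<close> is also \<open>\<beta>\<close> regarded as a vector with
  \<open>|T|\<close> entries.\<close>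

definition coord_space :: "'n set \<Rightarrow> (real ^ 'n) set" where
  "coord_space T = {\<beta>. \<forall>j. j \<notin> T \<longrightarrow> \<beta> $ j = 0}"

definition seminorm_on :: "(real ^ 'n) set \<Rightarrow> (real ^ 'n \<Rightarrow> real) \<Rightarrow> bool" where
  "seminorm_on V f \<longleftrightarrow>
     (\<forall>x\<in>V. 0 \<le> f x) \<and>
     (\<forall>x\<in>V. \<forall>a. f (a *\<^sub>R x) = \<bar>a\<bar> * f x) \<and>
     (\<forall>x\<in>V. \<forall>y\<in>V. f (x + y) \<le> f x + f y)"

definition norm_on :: "(real ^ 'n) set \<Rightarrow> (real ^ 'n \<Rightarrow> real) \<Rightarrow> bool" where
  "norm_on V f \<longleftrightarrow> seminorm_on V f \<and> (\<forall>x\<in>V. f x = 0 \<longrightarrow> x = 0)"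

text \<open>\<open>\<Omega>c\<close> is an associated norm witnessing that \<open>\<Omega>\<close> is weakly decomposable for \<open>S\<close>; its
  values outside \<^term>\<open>coord_space (- S)\<close> are irrelevant.\<close>

definition weakly_decomposable_via ::
  "(real ^ 'n \<Rightarrow> real) \<Rightarrow> 'n set \<Rightarrow> (real ^ 'n \<Rightarrow> real) \<Rightarrow> bool" where
  "weakly_decomposable_via \<Omega> S \<Omega>c \<longleftrightarrow>
     norm_on (coord_space (- S)) \<Omega>c \<and>
     (\<forall>\<beta>. \<Omega> \<beta> \<ge> \<Omega> (restr S \<beta>) + \<Omega>c (restr (- S) \<beta>))"

definition under_norm ::
  "(real ^ 'n \<Rightarrow> real) \<Rightarrow> (real ^ 'n \<Rightarrow> real) \<Rightarrow> 'n set \<Rightarrow> real ^ 'n \<Rightarrow> real" where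
  "under_norm \<Omega> \<Omega>c S \<beta> = \<Omega> (restr S \<beta>) + \<Omega>c (restr (- S) \<beta>)"

definition dual_norm :: "(real ^ 'n \<Rightarrow> real) \<Rightarrow> real ^ 'n \<Rightarrow> real" where
  "dual_norm \<Omega> w = (SUP \<beta>\<in>{\<beta>. \<Omega> \<beta> \<le> 1}. \<bar>w \<bullet> \<beta>\<bar>)"

definition subdiff :: "(real ^ 'n \<Rightarrow> real) \<Rightarrow> real ^ 'n \<Rightarrow> (real ^ 'n) set" where
  "subdiff \<Omega> \<beta> =
     (if \<beta> = 0 then {z. dual_norm \<Omega> z \<le> 1}
      else {z. dual_norm \<Omega> z = 1 \<and> z \<bullet> \<beta> = \<Omega> \<beta>})"

text \<open>The minimum is written as an infimum in the extended reals. It is attained when \<open>S\<close> is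
  nonempty, see \<open>Omega_eigenvalue_attained\<close> below; for empty \<open>S\<close> there is no feasible
  vector, and the value is \<open>\<infinity>\<close>.\<close>

definition Omega_eigenvalue ::
  "(real ^ 'n \<Rightarrow> real) \<Rightarrow> (real ^ 'n \<Rightarrow> real) \<Rightarrow> (real ^ 'n \<Rightarrow> real) \<Rightarrow> real \<Rightarrow> 'n set \<Rightarrow> ereal" where
  "Omega_eigenvalue \<Omega> \<Omega>c \<tau> L S =
     (INF \<beta>\<in>{\<beta>. \<Omega> (restr S \<beta>) = 1 \<and> \<Omega>c (restr (- S) \<beta>) \<le> L}.
        ereal (\<tau> (restr S \<beta> - restr (- S) \<beta>)))"

text \<open>Division of extended reals has \<open>1 / 0 = \<infinity>\<close> and \<open>1 / \<infinity> = 0\<close>.\<close>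

definition effective_sparsity ::
  "(real ^ 'n \<Rightarrow> real) \<Rightarrow> (real ^ 'n \<Rightarrow> real) \<Rightarrow> (real ^ 'n \<Rightarrow> real) \<Rightarrow> real \<Rightarrow> 'n set \<Rightarrow> ereal" where
  "effective_sparsity \<Omega> \<Omega>c \<tau> L S = 1 / Omega_eigenvalue \<Omega> \<Omega>c \<tau> L S"

text \<open>The argument ranges over the extended reals because the effective sparsity may be
  infinite, and the value may be \<open>\<infinity>\<close> also at a finite argument.\<close>

definition convex_conjugate :: "(real \<Rightarrow> real) \<Rightarrow> ereal \<Rightarrow> ereal" where
  "convex_conjugate G v = (SUP u\<in>{0..}. ereal u * v - ereal (G u))"

definition strictly_convex_on :: "real set \<Rightarrow> (real \<Rightarrow> real) \<Rightarrow> bool" where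
  "strictly_convex_on A f \<longleftrightarrow>
     (\<forall>x\<in>A. \<forall>y\<in>A. \<forall>t. x \<noteq> y \<longrightarrow> 0 < t \<longrightarrow> t < 1 \<longrightarrow>
        f ((1 - t) * x + t * y) < (1 - t) * f x + t * f y)"

text \<open>Gradient relative to \<open>C\<close>: the set need not be open, so the derivative is taken within it.\<close>

definition is_gradient_on ::
  "(real ^ 'n) set \<Rightarrow> (real ^ 'n \<Rightarrow> real) \<Rightarrow> (real ^ 'n \<Rightarrow> real ^ 'n) \<Rightarrow> bool" where
  "is_gradient_on C f g \<longleftrightarrow>
     (\<forall>\<beta>\<in>C. (f has_derivative (\<lambda>h. g \<beta> \<bullet> h)) (at \<beta> within C))"

lemma restr_in_coord_space: "restr T \<beta> \<in> coord_space T"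
  by (simp add: restr_def coord_space_def)

lemma restr_add: "restr T (x + y) = restr T x + restr T y"
  by (simp add: restr_def vec_eq_iff)

lemma restr_scaleR: "restr T (a *\<^sub>R x) = a *\<^sub>R restr T x"
  by (simp add: restr_def vec_eq_iff)

lemma restr_split: "restr S x + restr (- S) x = x"
  by (simp add: restr_def vec_eq_iff)

lemma restr_restr: "restr S (restr S x) = restr S x"
  by (simp add: restr_def vec_eq_iff)

lemma restr_compl_restr: "restr (- S) (restr S x) = 0"
  by (simp add: restr_def vec_eq_iff)

lemma linear_restr: "linear (restr T)"
  by (intro linearI restr_add restr_scaleR)

lemma seminorm_on_zero:
  assumes "seminorm_on V f" "0 \<in> V"
  shows "f 0 = 0"
  using assms unfolding seminorm_on_def by (metis abs_zero mult_zero_left scale_zero_left)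

lemma seminorm_on_continuous:
  fixes f :: "real ^ 'n::finite \<Rightarrow> real"
  assumes "seminorm_on UNIV f"
  shows "continuous_on UNIV f"
proof (rule convex_on_continuous[OF open_UNIV])
  show "convex_on UNIV f"
  proof (rule convex_onI)
    fix t :: real and x y :: "real ^ 'n"
    assume t: "0 < t" "t < 1"
    have sc: "f (a *\<^sub>R z) = \<bar>a\<bar> * f z" for a z
      using assms by (auto simp: seminorm_on_def)
    have "f ((1 - t) *\<^sub>R x + t *\<^sub>R y) \<le> f ((1 - t) *\<^sub>R x) + f (t *\<^sub>R y)"
      using assms unfolding seminorm_on_def by blast
    also have "\<dots> = (1 - t) * f x + t * f y"
      using t by (simp add: sc)
    finally show "f ((1 - t) *\<^sub>R x + t *\<^sub>R y) \<le> (1 - t) * f x + t * f y" .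
  qed simp
qed

lemma norm_on_lower_bound:
  fixes f :: "real ^ 'n::finite \<Rightarrow> real"
  assumes f: "norm_on UNIV f"
  obtains c where "c > 0" "\<And>x. c * norm x \<le> f x"
proof -
  have sn: "seminorm_on UNIV f" using f by (simp add: norm_on_def)
  let ?S = "sphere 0 1 :: (real ^ 'n) set"
  have "continuous_on ?S f"
    using seminorm_on_continuous[OF sn] continuous_on_subset by blast
  moreover have "?S \<noteq> {}" by simp
  ultimately obtain u where u: "u \<in> ?S" "\<And>x. x \<in> ?S \<Longrightarrow> f u \<le> f x"
    using continuous_attains_inf[of ?S f] by (metis compact_sphere)
  have "u \<noteq> 0" using u(1) by auto
  then have pos: "f u > 0"
    using f unfolding norm_on_def seminorm_on_def by (metis UNIV_I less_eq_real_def)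
  have "f u * norm x \<le> f x" for x
  proof (cases "x = 0")
    case True
    then show ?thesis using seminorm_on_zero[OF sn] by simp
  next
    case False
    have "f u \<le> f ((1 / norm x) *\<^sub>R x)"
      using False by (intro u(2)) simp
    also have "\<dots> = (1 / norm x) * f x"
      using sn by (simp add: seminorm_on_def)
    finally show ?thesis using False by (simp add: field_simps)
  qed
  with pos show ?thesis using that by blast
qed

lemma seminorm_on_restr:
  assumes "seminorm_on (coord_space T) f"
  shows "seminorm_on UNIV (\<lambda>x. f (restr T x))"
  using assms restr_in_coord_space[of T]
  by (simp add: seminorm_on_def restr_add restr_scaleR)

lemma bdd_above_dual_norm:
  fixes \<Omega> :: "real ^ 'n::finite \<Rightarrow> real"
  assumes "norm_on UNIV \<Omega>"
  shows "bdd_above ((\<lambda>\<beta>. \<bar>w \<bullet> \<beta>\<bar>) ` {\<beta>. \<Omega> \<beta> \<le> 1})"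
proof -
  obtain c where c: "c > 0" "\<And>x. c * norm x \<le> \<Omega> x"
    using norm_on_lower_bound[OF assms] by blast
  have "\<bar>w \<bullet> x\<bar> \<le> norm w * (1 / c)" if "\<Omega> x \<le> 1" for x
  proof -
    have "norm x \<le> 1 / c"
      using c(2)[of x] that c(1) by (simp add: field_simps)
    then show ?thesis
      by (meson Cauchy_Schwarz_ineq2 mult_left_mono norm_ge_zero order_trans)
  qed
  then show ?thesis by (intro bdd_aboveI2) auto
qed

lemma Omega_eigenvalue_attained:
  fixes \<Omega> \<Omega>c \<tau> :: "real ^ 'n::finite \<Rightarrow> real"
  assumes \<Omega>: "norm_on UNIV \<Omega>" and \<Omega>c: "norm_on (coord_space (- S)) \<Omega>c"
    and \<tau>: "seminorm_on UNIV \<tau>" and L: "L > 0" and S: "S \<noteq> {}"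
  shows "\<exists>\<beta>. \<Omega> (restr S \<beta>) = 1 \<and> \<Omega>c (restr (- S) \<beta>) \<le> L \<and>
           Omega_eigenvalue \<Omega> \<Omega>c \<tau> L S = ereal (\<tau> (restr S \<beta> - restr (- S) \<beta>))"
proof -
  define F where "F = {\<beta>. \<Omega> (restr S \<beta>) = 1 \<and> \<Omega>c (restr (- S) \<beta>) \<le> L}"
  let ?g = "\<lambda>\<beta>. \<tau> (restr S \<beta> - restr (- S) \<beta>)"
  have sn1: "seminorm_on UNIV (\<lambda>x. \<Omega> (restr S x))"
    using \<Omega> by (intro seminorm_on_restr) (auto simp: norm_on_def seminorm_on_def)
  have sn2: "seminorm_on UNIV (\<lambda>x. \<Omega>c (restr (- S) x))"
    using \<Omega>c by (intro seminorm_on_restr) (simp add: norm_on_def)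
  have ct1: "continuous_on UNIV (\<lambda>x. \<Omega> (restr S x))"
    and ct2: "continuous_on UNIV (\<lambda>x. \<Omega>c (restr (- S) x))"
    using sn1 sn2 seminorm_on_continuous by blast+
  have "closed F"
    unfolding F_def Collect_conj_eq using ct1 ct2
    by (intro closed_Int closed_Collect_eq closed_Collect_le) auto
  have nu: "norm_on UNIV (under_norm \<Omega> \<Omega>c S)"
    unfolding norm_on_def
  proof (intro conjI ballI impI)
    show "seminorm_on UNIV (under_norm \<Omega> \<Omega>c S)"
      using sn1 sn2 unfolding seminorm_on_def under_norm_def
      by (smt (verit, best) UNIV_I distrib_left)
    fix x assume "under_norm \<Omega> \<Omega>c S x = 0"
    moreover have "0 \<le> \<Omega> (restr S x)" "0 \<le> \<Omega>c (restr (- S) x)"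
      using sn1 sn2 by (auto simp: seminorm_on_def)
    ultimately have "\<Omega> (restr S x) = 0" "\<Omega>c (restr (- S) x) = 0"
      by (auto simp: under_norm_def)
    then have "restr S x = 0" "restr (- S) x = 0"
      using \<Omega> \<Omega>c restr_in_coord_space by (auto simp: norm_on_def)
    then show "x = 0" using restr_split[of S x] by simp
  qed
  obtain c where c: "c > 0" "\<And>x. c * norm x \<le> under_norm \<Omega> \<Omega>c S x"
    using norm_on_lower_bound[OF nu] by blast
  have "norm x \<le> (1 + L) / c" if "x \<in> F" for x
  proof -
    have "c * norm x \<le> 1 + L"
      using c(2)[of x] that by (simp add: F_def under_norm_def)
    then show ?thesis using c(1) by (simp add: field_simps)
  qed
  then have "bounded F" by (meson bounded_iff)
  with \<open>closed F\<close> have "compact F" by (simp add: compact_eq_bounded_closed)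
  have "F \<noteq> {}"
  proof -
    obtain j where j: "j \<in> S" using S by blast
    define x where "x = restr S (axis j (1::real))"
    have "x $ j = 1" using j by (simp add: x_def restr_def axis_def)
    then have "x \<noteq> 0" by auto
    then have pos: "\<Omega> x > 0"
      using \<Omega> unfolding norm_on_def seminorm_on_def by (metis UNIV_I less_eq_real_def)
    have "\<Omega> (restr S ((1 / \<Omega> x) *\<^sub>R x)) = (1 / \<Omega> x) * \<Omega> x"
      using \<Omega> pos unfolding restr_scaleR
      by (simp add: x_def restr_restr norm_on_def seminorm_on_def)
    moreover have "\<Omega>c (restr (- S) ((1 / \<Omega> x) *\<^sub>R x)) = 0"
      using \<Omega>c seminorm_on_zero[of "coord_space (- S)" \<Omega>c]
      by (simp add: restr_scaleR x_def restr_compl_restr norm_on_def coord_space_def)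
    ultimately have "(1 / \<Omega> x) *\<^sub>R x \<in> F" using pos L by (simp add: F_def)
    then show ?thesis by blast
  qed
  have cl: "continuous_on UNIV (\<lambda>\<beta>. restr S \<beta> - restr (- S) \<beta>)"
    by (intro linear_continuous_on linear_conv_bounded_linear[THEN iffD1]
        linear_compose_sub linear_restr)
  have "continuous_on UNIV ?g"
    using continuous_on_compose2[OF seminorm_on_continuous[OF \<tau>] cl] by simp
  then have "continuous_on F ?g" using continuous_on_subset by blast
  then obtain b where b: "b \<in> F" "\<And>x. x \<in> F \<Longrightarrow> ?g b \<le> ?g x"
    using continuous_attains_inf[OF \<open>compact F\<close> \<open>F \<noteq> {}\<close>] by blast
  have "(INF \<beta>\<in>F. ereal (?g \<beta>)) = ereal (?g b)"
    using b by (intro antisym INF_lower INF_greatest) auto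
  with b(1) show ?thesis
    unfolding Omega_eigenvalue_def F_def[symmetric] by (auto simp: F_def)
qed

lemma effective_sparsity_nonneg_and_square:
  assumes "seminorm_on UNIV \<tau>"
  shows "0 \<le> effective_sparsity \<Omega> \<Omega>c \<tau> L S"
    and "(effective_sparsity \<Omega> \<Omega>c \<tau> L S)^2 = 1 / (Omega_eigenvalue \<Omega> \<Omega>c \<tau> L S)^2"
proof -
  have nn: "0 \<le> Omega_eigenvalue \<Omega> \<Omega>c \<tau> L S"
    unfolding Omega_eigenvalue_def using assms
    by (intro INF_greatest) (simp add: seminorm_on_def)
  then show "0 \<le> effective_sparsity \<Omega> \<Omega>c \<tau> L S"
    unfolding effective_sparsity_def
    by (cases "Omega_eigenvalue \<Omega> \<Omega>c \<tau> L S") (auto simp: divide_ereal_def)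
  show "(effective_sparsity \<Omega> \<Omega>c \<tau> L S)^2 = 1 / (Omega_eigenvalue \<Omega> \<Omega>c \<tau> L S)^2"
    unfolding effective_sparsity_def using nn
    by (cases "Omega_eigenvalue \<Omega> \<Omega>c \<tau> L S") (auto simp: divide_ereal_def power2_eq_square)
qed

end

theory Submission
  imports Defs
begin

text \<open>
  Stationarity tested against \<^term>\<open>bstar\<close>, added to the two-point margin condition with base
  point \<^term>\<open>btilde\<close>, bounds \<open>R btilde - R bstar\<close> by three pieces: the empirical process term,
  controlled by hypothesis, the term \<open>lam * (ztilde \<bullet> (bstar - btilde))\<close>, and the gain
  \<open>- G (\<tau> (btilde - bstar))\<close>.

  The second piece is at most \<open>lam\<close> times the difference of the penalties
  (\<open>subdiff_inequality\<close>). Weak decomposability bounds this difference by \<open>\<Omega>\<close> of the error on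
  \<open>S\<close> minus \<open>\<Omega>c\<close> of the error off \<open>S\<close>, up to twice the size of \<^term>\<open>bstar\<close> off \<open>S\<close>
  (\<open>weakly_decomposable_triangle\<close>). Let \<open>a\<close> and \<open>b\<close> be the sizes of the error on and off \<open>S\<close>, and
  \<open>t\<close> its size in \<open>\<tau>\<close>. After adding \<open>\<delta> * lam_lower * (a + b)\<close> to both sides, the expression
  \<open>lam_upper * a - (1 - \<delta>) * lam_lower * b - (1 - \<gamma>) * G t\<close> has to be bounded by the conjugate
  term.

  If \<open>b\<close> is at least \<open>L * a\<close>, this expression is nonpositive, while the conjugate is nonnegative.
  Otherwise the error lies in the cone on which the \<open>\<Omega>\<close>-eigenvalue controls it: the eigenvalue is
  at most \<open>t / a\<close> (\<open>Omega_eigenvalue_cone\<close>). So \<open>a\<close> is at most \<open>t\<close> times the effective sparsity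
  when the latter is finite, and the Fenchel-Young inequality splits \<open>lam_upper * a\<close> into
  \<open>(1 - \<gamma>) * G t\<close> and the conjugate term (\<open>sparsity_fenchel_young\<close>).
\<close>

section \<open>Norms, subgradients and weak decomposability\<close>

lemma dual_norm_ineq:
  fixes \<Omega> :: "real ^ 'n::finite \<Rightarrow> real"
  assumes "norm_on UNIV \<Omega>"
  shows "\<bar>w \<bullet> x\<bar> \<le> dual_norm \<Omega> w * \<Omega> x"
proof (cases "x = 0")
  case True
  then show ?thesis
    using assms seminorm_on_zero[of UNIV \<Omega>] by (simp add: norm_on_def)
next
  case False
  then have pos: "\<Omega> x > 0"
    using assms unfolding norm_on_def seminorm_on_def by (metis UNIV_I less_eq_real_def)
  have "\<Omega> ((1 / \<Omega> x) *\<^sub>R x) = 1"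
    using assms pos by (simp add: norm_on_def seminorm_on_def)
  then have "\<bar>w \<bullet> ((1 / \<Omega> x) *\<^sub>R x)\<bar> \<le> dual_norm \<Omega> w"
    unfolding dual_norm_def by (intro cSUP_upper bdd_above_dual_norm assms) simp
  then show ?thesis
    using pos by (simp add: field_simps)
qed

text \<open>Elements of \<^const>\<open>subdiff\<close> are subgradients in the usual sense of convex analysis, since
  each of them attains the norm at the base point and is dominated by it elsewhere.\<close>

lemma subdiff_inequality:
  fixes \<Omega> :: "real ^ 'n::finite \<Rightarrow> real"
  assumes \<Omega>: "norm_on UNIV \<Omega>" and z: "z \<in> subdiff \<Omega> b"
  shows "z \<bullet> (x - b) \<le> \<Omega> x - \<Omega> b"
proof -
  have "\<Omega> 0 = 0" and nn: "0 \<le> \<Omega> x"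
    using \<Omega> seminorm_on_zero[of UNIV \<Omega>] by (auto simp: norm_on_def seminorm_on_def)
  then have dual: "dual_norm \<Omega> z \<le> 1" and base: "z \<bullet> b = \<Omega> b"
    using z by (auto simp: subdiff_def split: if_splits)
  have "z \<bullet> x \<le> dual_norm \<Omega> z * \<Omega> x"
    using dual_norm_ineq[OF \<Omega>, of z x] by linarith
  also have "\<dots> \<le> \<Omega> x"
    using mult_right_mono[OF dual nn] by simp
  finally show ?thesis
    by (simp add: inner_diff_right base)
qed

text \<open>The triangle inequality is used for \<open>\<Omega>\<close> on \<open>S\<close> and for \<open>\<Omega>c\<close> off \<open>S\<close>. The second use costs
  \<open>\<Omega>c\<close> of \<open>x\<close> off \<open>S\<close>, which \<open>\<Omega>\<close> dominates there: apply weak decomposability to a vector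
  that vanishes on \<open>S\<close>.\<close>

lemma weakly_decomposable_triangle:
  fixes \<Omega> \<Omega>c :: "real ^ 'n::finite \<Rightarrow> real"
  assumes \<Omega>: "seminorm_on UNIV \<Omega>" and wd: "weakly_decomposable_via \<Omega> S \<Omega>c"
  shows "\<Omega> x - \<Omega> b
    \<le> \<Omega> (restr S (b - x)) - \<Omega>c (restr (- S) (b - x)) + 2 * \<Omega> (restr (- S) x)"
proof -
  have tri: "\<Omega> (u + v) \<le> \<Omega> u + \<Omega> v" and neg: "\<Omega> (- u) = \<Omega> u" for u v
  proof -
    show "\<Omega> (u + v) \<le> \<Omega> u + \<Omega> v" using \<Omega> by (simp add: seminorm_on_def)
    have "\<Omega> ((- 1) *\<^sub>R u) = \<bar>- 1\<bar> * \<Omega> u" using \<Omega> unfolding seminorm_on_def by blast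
    then show "\<Omega> (- u) = \<Omega> u" by simp
  qed
  have restr_diff: "restr T (u - v) = restr T u - restr T v" for T and u v :: "real ^ 'n"
    by (rule linear_diff[OF linear_restr])
  define q where "q u = \<Omega>c (restr (- S) u)" for u
  have q: "seminorm_on UNIV q"
    using wd unfolding q_def weakly_decomposable_via_def norm_on_def
    by (intro seminorm_on_restr) blast
  have q_tri: "q (u + v) \<le> q u + q v" and q_neg: "q (- u) = q u" for u v
  proof -
    show "q (u + v) \<le> q u + q v" using q by (simp add: seminorm_on_def)
    have "q ((- 1) *\<^sub>R u) = \<bar>- 1\<bar> * q u" using q unfolding seminorm_on_def by blast
    then show "q (- u) = q u" by simp
  qed
  have dec: "\<Omega> (restr S u) + q u \<le> \<Omega> u" for u
    using wd by (simp add: weakly_decomposable_via_def q_def)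
  have on_S: "\<Omega> (restr S x) \<le> \<Omega> (restr S b) + \<Omega> (restr S (b - x))"
    using tri[of "restr S b" "- restr S (b - x)"] unfolding neg by (simp add: restr_diff)
  have off_S: "q (b - x) \<le> q b + q x"
    using q_tri[of b "- x"] by (simp add: q_neg)
  have "restr S (restr (- S) x) = 0"
    using restr_compl_restr[of "- S" x] by simp
  then have dom: "q x \<le> \<Omega> (restr (- S) x)"
    using dec[of "restr (- S) x"] seminorm_on_zero[OF \<Omega>] by (simp add: q_def restr_restr)
  have split: "\<Omega> x \<le> \<Omega> (restr S x) + \<Omega> (restr (- S) x)"
    using tri[of "restr S x" "restr (- S) x"] by (simp add: restr_split)
  show ?thesis
    using on_S off_S dom split dec[of b] unfolding q_def by linarith
qed

section \<open>Effective sparsity and the convex conjugate\<close>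

text \<open>Flipping the sign off \<open>S\<close> and rescaling makes a vector of the cone feasible for the
  minimum that defines the eigenvalue. The sign flip undoes the minus sign inside \<open>\<tau>\<close>.\<close>

lemma Omega_eigenvalue_cone:
  fixes \<Omega> \<Omega>c \<tau> :: "real ^ 'n::finite \<Rightarrow> real"
  assumes \<Omega>: "seminorm_on UNIV \<Omega>" and \<Omega>c: "seminorm_on (coord_space (- S)) \<Omega>c"
    and \<tau>: "seminorm_on UNIV \<tau>"
    and pos: "0 < \<Omega> (restr S d)"
    and cone: "\<Omega>c (restr (- S) d) \<le> L * \<Omega> (restr S d)"
  shows "Omega_eigenvalue \<Omega> \<Omega>c \<tau> L S \<le> ereal (\<tau> d / \<Omega> (restr S d))"
proof -
  define a where "a = \<Omega> (restr S d)"
  have a: "a > 0" using pos by (simp add: a_def)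
  define x where "x = (1 / a) *\<^sub>R (restr S d - restr (- S) d)"
  have on_S: "restr S x = (1 / a) *\<^sub>R restr S d"
    and off_S: "restr (- S) x = (- 1 / a) *\<^sub>R restr (- S) d"
    by (auto simp: x_def restr_def vec_eq_iff)
  have "\<Omega> (restr S x) = 1"
    using \<Omega> a unfolding on_S seminorm_on_def by (simp add: a_def)
  moreover have "\<Omega>c (restr (- S) x) \<le> L"
  proof -
    have "\<Omega>c (restr (- S) x) = \<bar>- 1 / a\<bar> * \<Omega>c (restr (- S) d)"
      using \<Omega>c restr_in_coord_space unfolding off_S seminorm_on_def by blast
    also have "\<dots> = \<Omega>c (restr (- S) d) / a"
      using a by simp
    also have "\<dots> \<le> L"
      using cone a by (simp add: a_def pos_divide_le_eq)
    finally show ?thesis .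
  qed
  moreover have "\<tau> (restr S x - restr (- S) x) = \<tau> d / a"
  proof -
    have "restr S x - restr (- S) x = (1 / a) *\<^sub>R (restr S d + restr (- S) d)"
      by (simp add: on_S off_S scaleR_add_right)
    then show ?thesis
      using \<tau> a by (simp add: restr_split seminorm_on_def)
  qed
  ultimately show ?thesis
    unfolding Omega_eigenvalue_def a_def by (intro INF_lower2[of x]) auto
qed

lemma convex_conjugate_nonneg:
  assumes "G 0 = 0"
  shows "0 \<le> convex_conjugate G v"
  unfolding convex_conjugate_def
  by (rule SUP_upper2[of 0]) (auto simp: assms zero_ereal_def[symmetric])

text \<open>The hypothesis on \<open>E\<close> means \<open>a \<le> t * (1 / E)\<close>, in a form that also covers \<open>E = 0\<close>. In
  that case the argument of the conjugate is infinite, and so is the conjugate, as testing it at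
  any positive point shows. For positive \<open>E\<close> the claim is the Fenchel-Young inequality at \<open>t\<close>,
  multiplied by \<open>c\<close>.\<close>

lemma sparsity_fenchel_young:
  fixes E :: ereal and a c k t :: real
  assumes E: "0 \<le> E" "E \<le> ereal (t / a)"
    and a: "0 < a" and c: "0 < c" and k: "0 < k" and t: "0 \<le> t"
  shows "ereal (k * a - c * G t) \<le> ereal c * convex_conjugate G (ereal k * (1 / E) / ereal c)"
    (is "_ \<le> _ * convex_conjugate G ?v")
proof (cases "E = 0")
  case True
  then have v: "?v = \<infinity>"
    using c k by (simp add: divide_ereal_def)
  have "ereal 1 * ?v - ereal (G 1) \<le> convex_conjugate G ?v"
    unfolding convex_conjugate_def by (rule SUP_upper) simp
  then have "convex_conjugate G ?v = \<infinity>"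
    by (simp add: v)
  with c show ?thesis by simp
next
  case False
  then obtain e where e: "E = ereal e" "e > 0"
    using E by (cases E) auto
  have v: "?v = ereal (k / (e * c))"
    using e c by (simp add: divide_ereal_def field_simps)
  have young: "ereal (t * (k / (e * c)) - G t) \<le> convex_conjugate G ?v"
    unfolding convex_conjugate_def v by (rule SUP_upper2[of t]) (use t in auto)
  have "k * a \<le> k * (t / e)"
    using E(2) e a k by (intro mult_left_mono) (auto simp: field_simps)
  also have "\<dots> = c * (t * (k / (e * c)))"
    using c e by (simp add: field_simps)
  finally have "k * a - c * G t \<le> c * (t * (k / (e * c)) - G t)"
    by (simp add: right_diff_distrib)
  then have "ereal (k * a - c * G t) \<le> ereal c * ereal (t * (k / (e * c)) - G t)"
    by simp
  also have "\<dots> \<le> ereal c * convex_conjugate G ?v"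
    using young c by (intro ereal_mult_left_mono) auto
  finally show ?thesis .
qed

section \<open>The sharp oracle inequality\<close>

theorem theorem2p1:
  fixes M :: "'w measure"
    and \<omega> :: 'w
    and C :: "(real ^ 'n::finite) set"
    and Rn :: "'w \<Rightarrow> real ^ 'n \<Rightarrow> real"
    and gradRn :: "'w \<Rightarrow> real ^ 'n \<Rightarrow> real ^ 'n"
    and R :: "real ^ 'n \<Rightarrow> real"
    and gradR :: "real ^ 'n \<Rightarrow> real ^ 'n"
    and G :: "real \<Rightarrow> real"
    and \<tau> \<Omega> \<Omega>c :: "real ^ 'n \<Rightarrow> real"
    and S :: "'n set"
    and bstar btilde ztilde :: "real ^ 'n"
    and lam lam_eps lam_star \<gamma> \<delta> lam_lower lam_upper L :: real
  assumes "prob_space M"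
    and "\<omega> \<in> space M"
    and "convex C"
    and "\<And>w. w \<in> space M \<Longrightarrow> is_gradient_on C (Rn w) (gradRn w)"
    and "\<And>\<beta>. \<beta> \<in> C \<Longrightarrow> integrable M (\<lambda>w. Rn w \<beta>)"
    and "\<And>\<beta>. \<beta> \<in> C \<Longrightarrow> R \<beta> = prob_space.expectation M (\<lambda>w. Rn w \<beta>)"
    and "is_gradient_on C R gradR"
    and "mono_on {0..} G"
    and "strictly_convex_on {0..} G"
    and "\<And>u. u \<ge> 0 \<Longrightarrow> G u \<ge> 0"
    and "G 0 = 0"
    and "seminorm_on UNIV \<tau>"
    and "\<And>\<beta>1 \<beta>2. \<beta>1 \<in> C \<Longrightarrow> \<beta>2 \<in> C \<Longrightarrow>
           R \<beta>1 - R \<beta>2 - gradR \<beta>2 \<bullet> (\<beta>1 - \<beta>2) \<ge> G (\<tau> (\<beta>1 - \<beta>2))"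
    and "bstar \<in> C"
    and "norm_on UNIV \<Omega>"
    and "weakly_decomposable_via \<Omega> S \<Omega>c"
    and "lam_eps > 0"
    and "lam_star \<ge> 0"
    and "0 \<le> \<gamma>" and "\<gamma> < 1"
    and "\<And>\<beta>'. \<beta>' \<in> C \<Longrightarrow>
           \<bar>(gradRn \<omega> \<beta>' - gradR \<beta>') \<bullet> (bstar - \<beta>')\<bar>
             \<le> lam_eps * under_norm \<Omega> \<Omega>c S (\<beta>' - bstar) + \<gamma> * G (\<tau> (\<beta>' - bstar)) + lam_star"
    and "lam > lam_eps"
    and "0 \<le> \<delta>" and "\<delta> < 1"
    and "lam_lower = lam - lam_eps"
    and "lam_upper = lam + lam_eps + \<delta> * lam_lower"
    and "L = lam_upper / ((1 - \<delta>) * lam_lower)"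
    and "btilde \<in> C"
    and "ztilde \<in> subdiff \<Omega> btilde"
    and "\<And>\<beta>. \<beta> \<in> C \<Longrightarrow> (gradRn \<omega> btilde + lam *\<^sub>R ztilde) \<bullet> (\<beta> - btilde) \<ge> 0"
  shows "ereal (\<delta> * lam_lower * under_norm \<Omega> \<Omega>c S (btilde - bstar) + R btilde)
           \<le> ereal (R bstar)
             + ereal (1 - \<gamma>) *
                 convex_conjugate G
                   (ereal lam_upper * effective_sparsity \<Omega> \<Omega>c \<tau> L S / ereal (1 - \<gamma>))
             + ereal (2 * lam * \<Omega> (restr (- S) bstar))
             + ereal lam_star"
proof -
  note \<gamma> = \<open>0 \<le> \<gamma>\<close> \<open>\<gamma> < 1\<close> and \<delta> = \<open>0 \<le> \<delta>\<close> \<open>\<delta> < 1\<close>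
  note G_nonneg = \<open>\<And>u. u \<ge> 0 \<Longrightarrow> G u \<ge> 0\<close>
  have lower_pos: "0 < lam_lower" and upper_pos: "0 < lam_upper"
    using \<open>lam > lam_eps\<close> \<open>lam_eps > 0\<close> \<delta> by (auto simp: assms(25,26) add_pos_nonneg)
  have \<Omega>: "seminorm_on UNIV \<Omega>"
    using \<open>norm_on UNIV \<Omega>\<close> by (simp add: norm_on_def)
  have \<Omega>c: "seminorm_on (coord_space (- S)) \<Omega>c"
    using \<open>weakly_decomposable_via \<Omega> S \<Omega>c\<close>
    by (simp add: weakly_decomposable_via_def norm_on_def)
  note \<tau> = \<open>seminorm_on UNIV \<tau>\<close>
  define d where "d = btilde - bstar"
  define a where "a = \<Omega> (restr S d)"
  define b where "b = \<Omega>c (restr (- S) d)"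
  define t where "t = \<tau> d"
  define E where "E = Omega_eigenvalue \<Omega> \<Omega>c \<tau> L S"
  define H where
    "H = convex_conjugate G (ereal lam_upper * effective_sparsity \<Omega> \<Omega>c \<tau> L S / ereal (1 - \<gamma>))"
  have "0 \<le> a" "0 \<le> t"
    using \<Omega> \<tau> by (auto simp: a_def t_def seminorm_on_def)
  have U: "under_norm \<Omega> \<Omega>c S (btilde - bstar) = a + b"
    by (simp add: under_norm_def a_def b_def d_def)
  have "\<tau> (bstar - btilde) = \<bar>- 1\<bar> * \<tau> d"
    using \<tau> unfolding seminorm_on_def d_def
    by (metis UNIV_I minus_diff_eq scaleR_minus1_left)
  then have t_sym: "\<tau> (bstar - btilde) = t"
    by (simp add: t_def)

  have margin: "R btilde + gradR btilde \<bullet> (bstar - btilde) + G t \<le> R bstar"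
    using assms(13)[OF \<open>bstar \<in> C\<close> \<open>btilde \<in> C\<close>] by (simp add: t_sym)
  have empirical: "(gradRn \<omega> btilde - gradR btilde) \<bullet> (bstar - btilde)
      \<le> lam_eps * (a + b) + \<gamma> * G t + lam_star"
    using assms(21)[OF \<open>btilde \<in> C\<close>] by (simp add: U t_def d_def)
  have stationary: "0 \<le> gradRn \<omega> btilde \<bullet> (bstar - btilde) + lam * (ztilde \<bullet> (bstar - btilde))"
    using assms(30)[OF \<open>bstar \<in> C\<close>] by (simp add: inner_add_left)
  have "ztilde \<bullet> (bstar - btilde) \<le> \<Omega> bstar - \<Omega> btilde"
    by (rule subdiff_inequality) fact+
  also have "\<dots> \<le> a - b + 2 * \<Omega> (restr (- S) bstar)"
    unfolding a_def b_def d_def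
    by (rule weakly_decomposable_triangle[OF \<Omega>]) fact
  finally have "lam * (ztilde \<bullet> (bstar - btilde)) \<le> lam * (a - b + 2 * \<Omega> (restr (- S) bstar))"
    using \<open>lam > lam_eps\<close> \<open>lam_eps > 0\<close> by (intro mult_left_mono) auto
  with margin empirical stationary
  have "R btilde + (1 - \<gamma>) * G t
      \<le> R bstar + lam_eps * (a + b) + lam_star + lam * (a - b + 2 * \<Omega> (restr (- S) bstar))"
    by (simp add: inner_diff_left algebra_simps)
  moreover have "\<delta> * lam_lower * (a + b) + lam_eps * (a + b) + lam * (a - b)
      = lam_upper * a - (1 - \<delta>) * lam_lower * b"
    unfolding assms(25,26) by (simp add: algebra_simps)
  ultimately have basic: "\<delta> * lam_lower * (a + b) + R btilde
      \<le> R bstar + (lam_upper * a - (1 - \<delta>) * lam_lower * b - (1 - \<gamma>) * G t)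
        + 2 * lam * \<Omega> (restr (- S) bstar) + lam_star"
    by (simp add: algebra_simps)

  have "ereal (lam_upper * a - (1 - \<delta>) * lam_lower * b - (1 - \<gamma>) * G t) \<le> ereal (1 - \<gamma>) * H"
  proof (cases "lam_upper * a \<le> (1 - \<delta>) * lam_lower * b")
    case True
    have "lam_upper * a - (1 - \<delta>) * lam_lower * b - (1 - \<gamma>) * G t \<le> 0"
      using True \<gamma> G_nonneg[OF \<open>0 \<le> t\<close>] mult_nonneg_nonneg[of "1 - \<gamma>" "G t"] by linarith
    moreover have "0 \<le> ereal (1 - \<gamma>) * H"
      using \<gamma> convex_conjugate_nonneg[of G] \<open>G 0 = 0\<close> by (simp add: H_def)
    ultimately show ?thesis
      by (cases "ereal (1 - \<gamma>) * H") auto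
  next
    case False
    have "0 \<le> b"
      using \<Omega>c restr_in_coord_space by (auto simp: b_def seminorm_on_def)
    then have off: "0 \<le> (1 - \<delta>) * lam_lower * b"
      using lower_pos \<delta> by simp
    with False upper_pos have "0 < a"
      by (smt (verit) mult_nonneg_nonpos)
    have "b \<le> L * a"
      using False lower_pos \<delta> by (simp add: \<open>L = _\<close> field_simps)
    have "E \<le> ereal (t / a)"
      unfolding E_def t_def a_def
      by (rule Omega_eigenvalue_cone[OF \<Omega> \<Omega>c \<tau>]) (use \<open>0 < a\<close> \<open>b \<le> L * a\<close> in \<open>simp_all add: a_def b_def\<close>)
    moreover have "0 \<le> E"
      using \<tau> unfolding E_def Omega_eigenvalue_def
      by (intro INF_greatest) (simp add: seminorm_on_def)
    ultimately have "ereal (lam_upper * a - (1 - \<gamma>) * G t) \<le> ereal (1 - \<gamma>) * H"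
      unfolding H_def effective_sparsity_def E_def[symmetric]
      by (intro sparsity_fenchel_young) (use \<open>0 < a\<close> \<open>0 \<le> t\<close> upper_pos \<gamma> in auto)
    moreover have "lam_upper * a - (1 - \<delta>) * lam_lower * b - (1 - \<gamma>) * G t
        \<le> lam_upper * a - (1 - \<gamma>) * G t"
      using off by simp
    ultimately show ?thesis
      by (meson ereal_less_eq(3) order_trans)
  qed
  then show ?thesis
    using basic unfolding U H_def[symmetric]
    by (cases "ereal (1 - \<gamma>) * H") auto
qed

end
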